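(* Let $u,v,w,n$ be non-negative integers. Let $A(n;u,v,w)$ be the number of colored overpartitions of size $n$ with positive potentials and colors in $\{a,b\}$ (i.e. finite sequences of primary particles with positive potentials satisfying the minimal difference conditions given by $D$), with $u$ particles of color $a$, $v$ particles of color $b$ (over-lined or not), and $w$ over-lined particles. Let $B(n;u,v,w)$ be the number of colored overpartitions of size $n$ with colors in $\{a,b,a^2,ab,ba,b^2\}$ (i.e. finite sequences of primary and secondary particles satisfying the minimal difference conditions given by $D'$), with positive potential for the primary particles and potential greater than one for the secondary particles, with $u$ occurrences of the symbol $a$, $v$ occurrences of the symbol $b$, and such that $w$ equals the number of over-lined particles plus twice the number of non over-lined particles which are either of color $ab$ with even potential, or of color $a^2$, $ba$ or $b^2$ with odd potential. Then $A(n;u,v,w)=B(n;u,v,w)$ and, with commuting variables $a,b,c,d,q$, $$\sum_{n,u,v,w\ge0}B(n;u,v,w)a^ub^vc^wd^{u+v-w}q^n=\sum_{n,u,v,w\ge0}A(n;u,v,w)a^ub^vc^wd^{u+v-w}q^n=\frac{(-acq;q)_\infty(-bcq;q)_\infty}{(adq;q)_\infty(bdq;q)_\infty}.$$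
   Context: Notation: $(x;q)_\infty=\prod_{k\ge0}(1-xq^k)$. Primary states: $\overline b,\overline a,a,b$. Here $\overline a,\overline b$ are viewed as over-lined particles of color $a,b$, and $a,b$ as non over-lined ones. Let $D$ be the $4\times4$ matrix with rows and columns indexed by $\overline b,\overline a,a,b$ in this order: $$D=\begin{pmatrix}1&1&1&1\\0&1&1&1\\0&0&0&1\\0&0&0&0\end{pmatrix}.$$ A primary particle is a pair (potential in $\mathbb{Z}$, primary state). Secondary states are the 16 non-commutative products $cc'$ of two primary states; a secondary particle has a secondary state $cc'$ and a potential in $\mathbb{Z}$ which has the same parity as $D(c,c')$. Secondary states are identified with colors $a^2,ab,ba,b^2$, over-lined or not, as follows (the parity of the potential is indicated). $\overline b\,\overline b$: non over-lined $b^2$, odd; $\overline b\,\overline a$: non over-lined $ba$, odd; $\overline b a$: over-lined $ba$, odd; $\overline b b$: over-lined $b^2$, odd; $\overline a\,\overline b$: non over-lined $ab$, even; $\overline a\,\overline a$: non over-lined $a^2$, odd; $\overline a a$: over-lined $a^2$, odd; $\overline a b$: over-lined $ab$, odd; $a\overline b$: over-lined $ab$, even; $a\overline a$: over-lined $a^2$, even; $aa$: non over-lined $a^2$, even; $ab$: non over-lined $ab$, odd; $b\overline b$: over-lined $b^2$, even; $b\overline a$: over-lined $ba$, even; $ba$: non over-lined $ba$, even; $bb$: non over-lined $b^2$, even. A particle of color $a$ contains one symbol $a$, of color $b$ one symbol $b$, of color $a^2$ two symbols $a$, of color $b^2$ two symbols $b$, and of color $ab$ or $ba$ one symbol $a$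 and one symbol $b$ (over-lined or not). The matrix $D'$ is indexed by the 4 primary and 16 secondary states, with entries, for primary states $c,c',c'',c'''$: $D'(c,c')=1+D(c,c')$; $D'(c,c'c'')=D(c,c')+D(c',c'')$; $D'(cc',c'')=1+D(c,c')+D(c',c'')$; $D'(cc',c''c''')=D(c,c')+2D(c',c'')+D(c'',c''')$. A finite sequence of particles $(\pi_1,\ldots,\pi_s)$ satisfies the minimal difference conditions given by a matrix $M$ if, for all $1\le i\le s-1$, the potential of $\pi_i$ minus the potential of $\pi_{i+1}$ is at least the entry of $M$ in the row of the state of $\pi_i$ and the column of the state of $\pi_{i+1}$. The size of the sequence is the sum of the potentials. The empty sequence is allowed. *)

theory Defs
  imports "HOL-Analysis.Analysis"
begin

datatype prim = B_bar | A_bar | A_plain | B_plain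

fun D :: "prim \<Rightarrow> prim \<Rightarrow> int" where
  "D B_bar _ = 1"
| "D A_bar B_bar = 0"
| "D A_bar _ = 1"
| "D A_plain B_plain = 1"
| "D A_plain _ = 0"
| "D B_plain _ = 0"

datatype state = Prim prim | Sec prim prim

fun D' :: "state \<Rightarrow> state \<Rightarrow> int" where
  "D' (Prim c) (Prim c') = 1 + D c c'"
| "D' (Prim c) (Sec c' c'') = D c c' + D c' c''"
| "D' (Sec c c') (Prim c'') = 1 + D c c' + D c' c''"
| "D' (Sec c c') (Sec c'' c''') = D c c' + 2 * D c' c'' + D c'' c'''"

datatype color = Col_a | Col_b | Col_aa | Col_ab | Col_ba | Col_bb

(* A label (o, col) consists of a color and a flag o telling whether it is over-lined. *)

fun prim_label :: "prim \<Rightarrow> bool \<times> color" where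
  "prim_label B_bar = (True, Col_b)"
| "prim_label A_bar = (True, Col_a)"
| "prim_label A_plain = (False, Col_a)"
| "prim_label B_plain = (False, Col_b)"

fun sec_label :: "prim \<Rightarrow> prim \<Rightarrow> bool \<times> color" where
  "sec_label B_bar B_bar = (False, Col_bb)"
| "sec_label B_bar A_bar = (False, Col_ba)"
| "sec_label B_bar A_plain = (True, Col_ba)"
| "sec_label B_bar B_plain = (True, Col_bb)"
| "sec_label A_bar B_bar = (False, Col_ab)"
| "sec_label A_bar A_bar = (False, Col_aa)"
| "sec_label A_bar A_plain = (True, Col_aa)"
| "sec_label A_bar B_plain = (True, Col_ab)"
| "sec_label A_plain B_bar = (True, Col_ab)"
| "sec_label A_plain A_bar = (True, Col_aa)"
| "sec_label A_plain A_plain = (False, Col_aa)"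
| "sec_label A_plain B_plain = (False, Col_ab)"
| "sec_label B_plain B_bar = (True, Col_bb)"
| "sec_label B_plain A_bar = (True, Col_ba)"
| "sec_label B_plain A_plain = (False, Col_ba)"
| "sec_label B_plain B_plain = (False, Col_bb)"

fun label :: "state \<Rightarrow> bool \<times> color" where
  "label (Prim c) = prim_label c"
| "label (Sec c c') = sec_label c c'"

definition overlined :: "state \<Rightarrow> bool" where
  "overlined s = fst (label s)"

definition color_of :: "state \<Rightarrow> color" where
  "color_of s = snd (label s)"

fun num_a :: "color \<Rightarrow> nat" where
  "num_a Col_a = 1"
| "num_a Col_b = 0"
| "num_a Col_aa = 2"
| "num_a Col_ab = 1"
| "num_a Col_ba = 1"
| "num_a Col_bb = 0"

fun num_b :: "color \<Rightarrow> nat" where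
  "num_b Col_a = 0"
| "num_b Col_b = 1"
| "num_b Col_aa = 0"
| "num_b Col_ab = 1"
| "num_b Col_ba = 1"
| "num_b Col_bb = 2"

(* A particle is a pair (potential, state). *)

definition min_diff :: "('s \<Rightarrow> 's \<Rightarrow> int) \<Rightarrow> (int \<times> 's) list \<Rightarrow> bool" where
  "min_diff M \<pi> \<longleftrightarrow>
     (\<forall>i. i + 1 < length \<pi> \<longrightarrow>
        fst (\<pi> ! i) - fst (\<pi> ! (i + 1)) \<ge> M (snd (\<pi> ! i)) (snd (\<pi> ! (i + 1))))"

definition seq_size :: "(int \<times> 's) list \<Rightarrow> int" where
  "seq_size \<pi> = (\<Sum>p\<leftarrow>\<pi>. fst p)"

definition seqs_A :: "nat \<Rightarrow> nat \<Rightarrow> nat \<Rightarrow> nat \<Rightarrow> (int \<times> prim) list set" where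
  "seqs_A n u v w = {\<pi>.
     min_diff D \<pi> \<and>
     (\<forall>(k, c) \<in> set \<pi>. k > 0) \<and>
     seq_size \<pi> = int n \<and>
     length (filter (\<lambda>(k, c). color_of (Prim c) = Col_a) \<pi>) = u \<and>
     length (filter (\<lambda>(k, c). color_of (Prim c) = Col_b) \<pi>) = v \<and>
     length (filter (\<lambda>(k, c). overlined (Prim c)) \<pi>) = w}"

definition num_A :: "nat \<Rightarrow> nat \<Rightarrow> nat \<Rightarrow> nat \<Rightarrow> nat" where
  "num_A n u v w = card (seqs_A n u v w)"

(* For secondary particles, the parity constraint is part of what a particle is;
   the bound 1 comes from the condition on potentials in the count. *)
fun admissible :: "int \<times> state \<Rightarrow> bool" where
  "admissible (k, Prim c) \<longleftrightarrow> k > 0"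
| "admissible (k, Sec c c') \<longleftrightarrow> (even k \<longleftrightarrow> even (D c c')) \<and> k > 1"

definition counted_twice :: "int \<times> state \<Rightarrow> bool" where
  "counted_twice = (\<lambda>(k, s). \<not> overlined s \<and>
     (color_of s = Col_ab \<and> even k \<or> color_of s \<in> {Col_aa, Col_ba, Col_bb} \<and> odd k))"

definition seqs_B :: "nat \<Rightarrow> nat \<Rightarrow> nat \<Rightarrow> nat \<Rightarrow> (int \<times> state) list set" where
  "seqs_B n u v w = {\<pi>.
     min_diff D' \<pi> \<and>
     (\<forall>p \<in> set \<pi>. admissible p) \<and>
     seq_size \<pi> = int n \<and>
     (\<Sum>(k, s)\<leftarrow>\<pi>. num_a (color_of s)) = u \<and>
     (\<Sum>(k, s)\<leftarrow>\<pi>. num_b (color_of s)) = v \<and>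
     length (filter (\<lambda>(k, s). overlined s) \<pi>) + 2 * length (filter counted_twice \<pi>) = w}"

definition num_B :: "nat \<Rightarrow> nat \<Rightarrow> nat \<Rightarrow> nat \<Rightarrow> nat" where
  "num_B n u v w = card (seqs_B n u v w)"

(* The variable q is the formal variable fps_X; the limit of the partial products is
   taken in the topology of formal power series (coefficientwise, discrete coefficients). *)
definition qpoch_inf :: "'k::field fps \<Rightarrow> 'k fps" where
  "qpoch_inf x = (\<Prod>k. 1 - x * fps_X ^ k)"

(* The term f(n;u,v,w) a^u b^v c^w d^(u+v-w) q^n. The values a, b, c, d range over an
   arbitrary field; four independent indeterminates are the case of a field of rational
   functions. The exponent of d is an integer, with no truncated subtraction. *)
definition gf_term ::
    "(nat \<Rightarrow> nat \<Rightarrow> nat \<Rightarrow> nat \<Rightarrow> nat) \<Rightarrow> 'k \<Rightarrow> 'k \<Rightarrow> 'k \<Rightarrow> 'k \<Rightarrow> nat \<times> nat \<times> nat \<times> nat \<Rightarrow> 'k::field fps"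
  where "gf_term f a b c d = (\<lambda>(n, u, v, w).
    fps_const (of_nat (f n u v w) * a ^ u * b ^ v * c ^ w * d powi (int u + int v - int w)) * fps_X ^ n)"

end

theory Submission
  imports Defs
begin

text \<open>
  Both kinds of sequences spell a word in the four primary states: a secondary particle
  contributes its two letters. The refined statement proved here is that, for every fixed word
  \<open>c\<^sub>1 \<dots> c\<^sub>s\<close>, there are as many sequences of either kind of every size. Since the numbers of
  symbols \<open>a\<close> and \<open>b\<close> and the statistic \<open>w\<close> depend on the word only (\<open>word_stats_word\<close>), this
  gives \<open>A = B\<close>.

  Let \<open>m\<^sub>i\<close> (\<open>least_pot\<close>) be the least positive potential that \<open>c\<^sub>i\<close> can have in a sequence of
  primary particles; \<open>m\<^sub>i - m\<^sub>i\<^sub>+\<^sub>1 = D c\<^sub>i c\<^sub>i\<^sub>+\<^sub>1\<close> is 0 or 1. Measured from \<open>m\<close>, a sequence of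
  primary particles is a weakly decreasing list of \<open>s\<close> natural numbers. Such a list is a multiset;
  its elements of odd multiplicity form a set \<open>X\<close>, and what remains is a multiset \<open>Z\<close> taken twice.
  So the word is decorated with a strictly decreasing list \<open>xs\<close> and a weakly decreasing list \<open>zs\<close>
  with \<open>|xs| + 2|zs| = s\<close>, and the size is \<open>\<Sum>m + \<Sum>xs + 2\<Sum>zs\<close> (\<open>bij_betw_raise\<close>).

  In a sequence of primary and secondary particles, write the potential of a primary particle at
  letter \<open>i\<close> as \<open>m\<^sub>i + x\<close> and that of a secondary particle at the letters \<open>i, i+1\<close> as
  \<open>m\<^sub>i + m\<^sub>i\<^sub>+\<^sub>1 + 2z\<close>, which is possible because of the parity condition. The condition
  given by \<open>D'\<close> between adjacent particles then reads \<open>x > x'\<close> for two primary particles and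
  \<open>z \<ge> z'\<close> for two secondary ones, while a primary particle at letter \<open>i\<close> next to a secondary
  particle must satisfy \<open>x \<ge> 2z + m\<^sub>i\<^sub>+\<^sub>1\<close>, and a secondary particle at the letters \<open>i, i+1\<close> next to a
  primary one \<open>x < 2z + m\<^sub>i\<^sub>+\<^sub>1\<close>. The two mixed conditions are complementary, so in reading a word
  from the left the next \<open>x\<close> and the next \<open>z\<close> decide which of them comes first: the particles
  recover the same data \<open>xs, zs\<close>, and these interleave in exactly one way (\<open>bij_betw_interleave\<close>).

  For the product, the condition given by \<open>D\<close> compares adjacent particles in a total order of the
  primary particles, and allows exactly those that are not over-lined to be repeated. Hence a particle of potential \<open>k\<close> and weight \<open>t\<close>
  contributes \<open>1 + t q\<^sup>k\<close> or \<open>1 / (1 - t q\<^sup>k)\<close> to the generating function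
  (\<open>overpartition_series_below_step\<close>), and a limit in the topology of formal power series yields the
  infinite products (\<open>overpartition_series_eq\<close>).
\<close>

unbundle no vec_syntax
unbundle fps_syntax

section \<open>Difference conditions between neighbours\<close>

lemma min_diff_simps [simp]:
  "min_diff M []"
  "min_diff M [p]"
  "min_diff M (p # q # \<pi>) \<longleftrightarrow> fst p - fst q \<ge> M (snd p) (snd q) \<and> min_diff M (q # \<pi>)"
proof -
  show "min_diff M (p # q # \<pi>) \<longleftrightarrow> fst p - fst q \<ge> M (snd p) (snd q) \<and> min_diff M (q # \<pi>)"
    (is "?L \<longleftrightarrow> ?R")
  proof
    assume L: ?L
    have "M (snd p) (snd q) \<le> fst p - fst q" using L[unfolded min_diff_def, rule_format, of 0] by simp
    moreover have "min_diff M (q # \<pi>)"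
      unfolding min_diff_def
    proof (intro allI impI)
      fix i assume "i + 1 < length (q # \<pi>)"
      then show "M (snd ((q # \<pi>) ! i)) (snd ((q # \<pi>) ! (i + 1))) \<le> fst ((q # \<pi>) ! i) - fst ((q # \<pi>) ! (i + 1))"
        using L[unfolded min_diff_def, rule_format, of "Suc i"] by simp
    qed
    ultimately show ?R by simp
  next
    assume R: ?R
    show ?L unfolding min_diff_def
    proof (intro allI impI)
      fix i assume "i + 1 < length (p # q # \<pi>)"
      then show "M (snd ((p # q # \<pi>) ! i)) (snd ((p # q # \<pi>) ! (i + 1))) \<le> fst ((p # q # \<pi>) ! i) - fst ((p # q # \<pi>) ! (i + 1))"
        using R by (cases i) (auto simp: min_diff_def)
    qed
  qed
qed (simp_all add: min_diff_def)

lemma min_diff_ConsD: "min_diff M (p # \<pi>) \<Longrightarrow> min_diff M \<pi>"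
  by (cases \<pi>) auto

section \<open>Least potentials along a word\<close>

text \<open>
  The least positive potential of the first letter of a word. The value 0 for the empty word acts as
  a sentinel: with it, prefixing a letter raises the value by 0 or 1 in all cases, so that the
  inequalities below hold up to the last particle of a sequence.
\<close>

fun least_pot :: "prim list \<Rightarrow> int" where
  "least_pot [] = 0"
| "least_pot [c] = 1"
| "least_pot (c # c' # cs) = D c c' + least_pot (c' # cs)"

fun least_size :: "prim list \<Rightarrow> int" where
  "least_size [] = 0"
| "least_size (c # cs) = least_pot (c # cs) + least_size cs"

lemma D_bounds: "0 \<le> D c c'" "D c c' \<le> 1"
  by (cases c; cases c'; simp)+

lemma least_pot_Cons: "least_pot (c # cs) = (case cs of [] \<Rightarrow> 1 | c' # _ \<Rightarrow> D c c' + least_pot cs)"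
  by (cases cs) auto

lemma least_pot_bounds:
  "least_pot cs \<le> least_pot (c # cs)" "least_pot (c # cs) \<le> least_pot cs + 1"
  using D_bounds by (auto simp: least_pot_Cons split: list.splits)

lemma least_pot_Cons_pos: "1 \<le> least_pot (c # cs)"
  by (induction cs arbitrary: c) (use D_bounds in \<open>auto intro: add_increasing\<close>)

lemma least_pot_nonneg: "0 \<le> least_pot cs"
  using least_pot_Cons_pos[of "hd cs" "tl cs"] by (cases cs) auto

section \<open>Sequences of primary and secondary particles\<close>

fun letters :: "state \<Rightarrow> prim list" where
  "letters (Prim c) = [c]"
| "letters (Sec c c') = [c, c']"

definition word :: "(int \<times> state) list \<Rightarrow> prim list" where
  "word \<pi> = concat (map (\<lambda>p. letters (snd p)) \<pi>)"

lemma word_simps [simp]: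
  "word [] = []"
  "word ((k, s) # \<pi>) = letters s @ word \<pi>"
  by (simp_all add: word_def)

text \<open>
  The reduced coordinates: \<open>singles\<close> lists the excess \<open>x\<close> of the primary particles over the least
  potentials, \<open>pairs\<close> lists half of the excess of the secondary particles over the sum of the least
  potentials of their two letters.
\<close>

fun singles :: "(int \<times> state) list \<Rightarrow> int list" where
  "singles [] = []"
| "singles ((k, Prim c) # \<pi>) = (k - least_pot (c # word \<pi>)) # singles \<pi>"
| "singles ((k, Sec c c') # \<pi>) = singles \<pi>"

fun pairs :: "(int \<times> state) list \<Rightarrow> int list" where
  "pairs [] = []"
| "pairs ((k, Prim c) # \<pi>) = pairs \<pi>"
| "pairs ((k, Sec c c') # \<pi>) =
     ((k - least_pot (c # c' # word \<pi>) - least_pot (c' # word \<pi>)) div 2) # pairs \<pi>"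

text \<open>
  The only candidate for a sequence with given word and reduced coordinates. Lists that do not fit
  the length of the word make it use an unspecified \<open>hd []\<close>; they do not occur below.
\<close>

fun interleave :: "prim list \<Rightarrow> int list \<Rightarrow> int list \<Rightarrow> (int \<times> state) list" where
  "interleave cs [] [] = []"
| "interleave cs (x # xs) [] = (least_pot cs + x, Prim (hd cs)) # interleave (tl cs) xs []"
| "interleave cs [] (z # zs) =
     (least_pot cs + least_pot (tl cs) + 2 * z, Sec (hd cs) (hd (tl cs))) # interleave (tl (tl cs)) [] zs"
| "interleave cs (x # xs) (z # zs) =
     (if x \<ge> 2 * z + least_pot (tl cs)
      then (least_pot cs + x, Prim (hd cs)) # interleave (tl cs) xs (z # zs)
      else (least_pot cs + least_pot (tl cs) + 2 * z, Sec (hd cs) (hd (tl cs)))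
             # interleave (tl (tl cs)) (x # xs) zs)"

definition valid :: "(int \<times> state) list \<Rightarrow> bool" where
  "valid \<pi> \<longleftrightarrow> min_diff D' \<pi> \<and> (\<forall>p \<in> set \<pi>. admissible p)"

lemma valid_ConsD: "valid (p # \<pi>) \<Longrightarrow> valid \<pi>"
  by (auto simp: valid_def dest: min_diff_ConsD)

text \<open>
  The parity condition on secondary particles says that the excess is even, since the least
  potentials of the letters \<open>c\<close>, \<open>c'\<close> add up to \<open>D c c'\<close> plus an even number.
\<close>

lemma pair_potential:
  assumes "admissible (k, Sec c c')"
  shows "k = least_pot (c # c' # cs) + least_pot (c' # cs)
           + 2 * ((k - least_pot (c # c' # cs) - least_pot (c' # cs)) div 2)"
proof -
  have "even (k - least_pot (c # c' # cs) - least_pot (c' # cs))"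
    using assms by (auto simp: algebra_simps)
  then show ?thesis by (simp add: algebra_simps)
qed

text \<open>
  A primary particle is compared here with the first later secondary particle, which need not be
  adjacent. Each primary particle in between lowers \<open>x\<close> by at least 1 and the threshold by at most
  1, as \<open>D \<le> 1\<close>. If there is no later secondary particle, a virtual \<open>z = 0\<close> takes its place.
\<close>

lemma single_first:
  assumes "valid ((k, Prim c) # \<pi>)"
  shows "k - least_pot (c # word \<pi>) \<ge> 2 * hd (pairs \<pi> @ [0]) + least_pot (word \<pi>)"
  using assms
proof (induction \<pi> arbitrary: k c)
  case Nil
  then show ?case by (simp add: valid_def)
next
  case (Cons q \<pi>)
  obtain l s where q: "q = (l, s)" by force
  have IH: "valid ((l, s) # \<pi>)"
    using Cons.prems q valid_ConsD by blast
  show ?case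
  proof (cases s)
    case (Prim c')
    have "k - l \<ge> 1 + D c c'"
      using Cons.prems by (simp add: valid_def q Prim)
    moreover have "l - least_pot (c' # word \<pi>) \<ge> 2 * hd (pairs \<pi> @ [0]) + least_pot (word \<pi>)"
      using Cons.IH IH Prim by blast
    ultimately show ?thesis
      using least_pot_bounds(2)[of c' "word \<pi>"] by (simp add: q Prim)
  next
    case (Sec c' c'')
    have "k - l \<ge> D c c' + D c' c''" "admissible (l, Sec c' c'')"
      using Cons.prems by (simp_all add: valid_def q Sec)
    with pair_potential[of l c' c'' "word \<pi>"] show ?thesis
      by (simp add: q Sec)
  qed
qed

text \<open>
  The counterpart for a secondary particle and the first later primary one. Between them \<open>z\<close> does not
  increase, and neither does the threshold, as \<open>D \<ge> 0\<close>. The conclusion is \<open>x < 2z + m\<close> with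
  \<open>m = least_pot (c' # word \<pi>)\<close>, from which \<open>m\<close> has been cancelled.
\<close>

lemma pair_first:
  assumes "valid ((k, Sec c c') # \<pi>)" "singles \<pi> = x # xs"
  shows "k - least_pot (c # c' # word \<pi>) > x"
  using assms
proof (induction \<pi> arbitrary: k c c')
  case Nil
  then show ?case by simp
next
  case (Cons q \<pi>)
  obtain l s where q: "q = (l, s)" by force
  have IH: "valid ((l, s) # \<pi>)"
    using Cons.prems q valid_ConsD by blast
  show ?case
  proof (cases s)
    case (Prim c'')
    then show ?thesis
      using Cons.prems by (auto simp: valid_def q)
  next
    case (Sec d d')
    have "k - l \<ge> D c c' + 2 * D c' d + D d d'"
      using Cons.prems by (simp add: valid_def q Sec)
    moreover have "l - least_pot (d # d' # word \<pi>) > x"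
      using Cons IH Sec q by auto
    ultimately show ?thesis
      using D_bounds(1)[of c' d] D_bounds(1)[of d d'] by (simp add: q Sec)
  qed
qed

text \<open>
  Two consecutive primary particles with secondary ones in between are compared through a secondary
  particle, with \<open>single_first\<close> on one side and \<open>pair_first\<close> on the other.
\<close>

lemma singles_decreasing:
  assumes "valid \<pi>"
  shows "sorted_wrt (>) (singles \<pi>)"
  using assms
proof (induction \<pi>)
  case (Cons p \<pi>)
  obtain k s where p: "p = (k, s)" by force
  have IH: "sorted_wrt (>) (singles \<pi>)" "valid \<pi>"
    using Cons valid_ConsD by blast+
  show ?case
  proof (cases s)
    case (Prim c)
    have "k - least_pot (c # word \<pi>) > x" if x: "singles \<pi> = x # xs" for x xs
    proof -
      obtain l s' \<rho> where \<pi>: "\<pi> = (l, s') # \<rho>"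
        using x by (cases \<pi>) auto
      show ?thesis
      proof (cases s')
        case (Prim c')
        then show ?thesis
          using Cons.prems x p \<open>s = Prim c\<close> by (auto simp: valid_def \<pi>)
      next
        case (Sec d d')
        have "x < 2 * hd (pairs \<pi>) + least_pot (d' # word \<rho>)"
          using pair_first[of l d d' \<rho> x xs] x \<open>valid \<pi>\<close>
            pair_potential[of l d d' "word \<rho>"] by (simp add: \<pi> Sec valid_def)
        also have "\<dots> \<le> 2 * hd (pairs \<pi>) + least_pot (word \<pi>)"
          using least_pot_bounds(1)[of "d' # word \<rho>" d] by (simp add: \<pi> Sec)
        also have "\<dots> \<le> k - least_pot (c # word \<pi>)"
          using single_first[of k c \<pi>] Cons.prems p \<open>s = Prim c\<close> by (simp add: \<pi> Sec)
        finally show ?thesis .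
      qed
    qed
    then show ?thesis
      using IH by (cases "singles \<pi>") (auto simp: p Prim)
  next
    case (Sec c c')
    then show ?thesis using IH by (simp add: p)
  qed
qed simp

text \<open>
  A secondary particle followed by a primary one gives only \<open>2z > 2z' - 2\<close> when compared with the
  next secondary particle, because the threshold can drop by 2 over two letters; integrality of \<open>z\<close>
  does the rest. The appended 0 includes the non-negativity of the entries.
\<close>

lemma pairs_decreasing:
  assumes "valid \<pi>"
  shows "sorted_wrt (\<ge>) (pairs \<pi> @ [0])"
  using assms
proof (induction \<pi>)
  case (Cons p \<pi>)
  obtain k s where p: "p = (k, s)" by force
  have IH: "sorted_wrt (\<ge>) (pairs \<pi> @ [0])" "valid \<pi>"
    using Cons valid_ConsD by blast+
  show ?case
  proof (cases s)
    case (Prim c)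
    then show ?thesis using IH by (simp add: p)
  next
    case (Sec c c')
    define z where "z = (k - least_pot (c # c' # word \<pi>) - least_pot (c' # word \<pi>)) div 2"
    have k: "k = least_pot (c # c' # word \<pi>) + least_pot (c' # word \<pi>) + 2 * z"
      using pair_potential[of k c c' "word \<pi>"] Cons.prems by (simp add: z_def p Sec valid_def)
    have "z \<ge> hd (pairs \<pi> @ [0])"
    proof (cases \<pi>)
      case Nil
      then show ?thesis using Cons.prems D_bounds[of c c'] k by (auto simp: valid_def p Sec)
    next
      case (Cons q \<rho>)
      obtain l s' where q: "q = (l, s')" by force
      show ?thesis
      proof (cases s')
        case (Prim d)
        have "k - l \<ge> 1 + D c c' + D c' d"
          using Cons.prems by (simp add: valid_def p q Cons Sec Prim)
        moreover have "l - least_pot (d # word \<rho>) \<ge> 2 * hd (pairs \<rho> @ [0]) + least_pot (word \<rho>)"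
          using single_first[of l d \<rho>] \<open>valid \<pi>\<close> by (simp add: Cons q Prim)
        ultimately have "2 * hd (pairs \<pi> @ [0]) < 2 * z + 2"
          using k least_pot_bounds(2)[of d "word \<rho>"] D_bounds[of c' d] 
          by (simp add: Cons q Prim)
        then show ?thesis by simp
      next
        case (Sec d d')
        have "k - l \<ge> D c c' + 2 * D c' d + D d d'"
          using Cons.prems by (simp add: valid_def p q Cons Sec \<open>s = Sec c c'\<close>)
        then show ?thesis
          using k pair_potential[of l d d' "word \<rho>"] \<open>valid \<pi>\<close> by (simp add: Cons q Sec valid_def)
      qed
    qed
    then have "sorted_wrt (\<ge>) (z # pairs \<pi> @ [0])"
      using IH by (cases "pairs \<pi>") auto
    then show ?thesis
      using z_def by (simp add: p Sec)
  qed
qed simp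

lemma singles_nonneg:
  assumes "valid \<pi>"
  shows "\<forall>x \<in> set (singles \<pi>). x \<ge> 0"
  using assms
proof (induction \<pi>)
  case (Cons p \<pi>)
  obtain k s where p: "p = (k, s)" by force
  have IH: "\<forall>x \<in> set (singles \<pi>). x \<ge> 0" and \<pi>: "valid \<pi>"
    using Cons valid_ConsD by blast+
  have "hd (pairs \<pi> @ [0]) \<ge> 0"
    using pairs_decreasing[OF \<pi>] by (cases "pairs \<pi>") auto
  then show ?case
    using IH single_first[of k _ \<pi>] Cons.prems least_pot_nonneg[of "word \<pi>"]
    by (cases s) (fastforce simp: p)+
qed simp

lemma length_word: "length (word \<pi>) = length (singles \<pi>) + 2 * length (pairs \<pi>)"
  by (induction \<pi> rule: pairs.induct) auto

lemma seq_size_B: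
  assumes "\<forall>p \<in> set \<pi>. admissible p"
  shows "seq_size \<pi> = least_size (word \<pi>) + sum_list (singles \<pi>) + 2 * sum_list (pairs \<pi>)"
  using assms
proof (induction \<pi> rule: pairs.induct)
  case (3 k c c' \<pi>)
  then show ?case using pair_potential[of k c c' "word \<pi>"] by (simp add: seq_size_def)
qed (simp_all add: seq_size_def)

text \<open>
  Uniqueness: in every sequence satisfying the conditions, the order of the particles is the one that
  the comparison in \<open>interleave\<close> selects, by \<open>single_first\<close> and \<open>pair_first\<close>.
\<close>

lemma interleave_word_singles_pairs:
  assumes "valid \<pi>"
  shows "interleave (word \<pi>) (singles \<pi>) (pairs \<pi>) = \<pi>"
  using assms
proof (induction \<pi>)
  case (Cons p \<pi>)
  obtain k s where p: "p = (k, s)" by force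
  have IH: "interleave (word \<pi>) (singles \<pi>) (pairs \<pi>) = \<pi>"
    using Cons valid_ConsD by blast
  show ?case
  proof (cases s)
    case (Prim c)
    then show ?thesis
      using IH single_first[of k c \<pi>] Cons.prems by (cases "pairs \<pi>") (auto simp: p)
  next
    case (Sec c c')
    then show ?thesis
      using IH pair_first[of k c c' \<pi>] Cons.prems pair_potential[of k c c' "word \<pi>"]
      by (cases "singles \<pi>") (auto simp: p valid_def)
  qed
qed simp

lemma read_interleave:
  assumes "length cs = length xs + 2 * length zs"
  shows "word (interleave cs xs zs) = cs \<and> singles (interleave cs xs zs) = xs \<and> pairs (interleave cs xs zs) = zs"
  using assms
proof (induction cs xs zs rule: interleave.induct)
  case (2 cs x xs)
  then show ?case by (cases cs) auto
next
  case (3 cs z zs)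
  then obtain c c' ds where "cs = c # c' # ds"
    by (auto simp: Suc_length_conv length_Suc_conv)
  with 3 show ?case by auto
next
  case (4 cs x xs z zs)
  then obtain c c' ds where "cs = c # c' # ds"
    by (auto simp: Suc_length_conv length_Suc_conv)
  with 4 show ?case by auto
qed simp

lemma valid_Cons_single:
  assumes "valid \<pi>" "x \<ge> 0"
    and "\<And>x' xs. singles \<pi> = x' # xs \<Longrightarrow> x > x'"
    and "\<And>z zs. pairs \<pi> = z # zs \<Longrightarrow> x \<ge> 2 * z + least_pot (word \<pi>)"
  shows "valid ((least_pot (c # word \<pi>) + x, Prim c) # \<pi>)"
proof (cases \<pi>)
  case Nil
  then show ?thesis using assms(2) by (simp add: valid_def)
next
  case (Cons q \<rho>)
  obtain l s where q: "q = (l, s)" by force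
  have adm: "admissible (least_pot (c # word \<pi>) + x, Prim c)"
    using assms(2) least_pot_Cons_pos[of c "word \<pi>"] by simp
  show ?thesis
  proof (cases s)
    case (Prim c')
    then show ?thesis using assms(1,3) adm by (auto simp: Cons q valid_def)
  next
    case (Sec d d')
    then show ?thesis
      using assms(1,4) adm pair_potential[of l d d' "word \<rho>"] by (auto simp: Cons q valid_def)
  qed
qed

lemma valid_Cons_pair:
  assumes "valid \<pi>" "z \<ge> 0"
    and "\<And>x xs. singles \<pi> = x # xs \<Longrightarrow> x < 2 * z + least_pot (c' # word \<pi>)"
    and "\<And>z' zs. pairs \<pi> = z' # zs \<Longrightarrow> z \<ge> z'"
  shows "valid ((least_pot (c # c' # word \<pi>) + least_pot (c' # word \<pi>) + 2 * z, Sec c c') # \<pi>)"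
proof -
  have adm: "admissible (least_pot (c # c' # word \<pi>) + least_pot (c' # word \<pi>) + 2 * z, Sec c c')"
    using assms(2) least_pot_Cons_pos[of c' "word \<pi>"] least_pot_Cons_pos[of c "c' # word \<pi>"]
    by auto
  show ?thesis
  proof (cases \<pi>)
    case Nil
    then show ?thesis using adm by (simp add: valid_def)
  next
    case (Cons q \<rho>)
    obtain l s where q: "q = (l, s)" by force
    show ?thesis
    proof (cases s)
      case (Prim d)
      then show ?thesis using assms(1,3) adm by (auto simp: Cons q valid_def)
    next
      case (Sec d d')
      then have "admissible (l, Sec d d')"
        using assms(1) by (simp add: Cons q valid_def)
      moreover have "z \<ge> (l - least_pot (d # d' # word \<rho>) - least_pot (d' # word \<rho>)) div 2"
        using assms(4) by (simp add: Cons q Sec)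
      ultimately have "l \<le> least_pot (d # d' # word \<rho>) + least_pot (d' # word \<rho>) + 2 * z"
        using pair_potential[of l d d' "word \<rho>"] by linarith
      then show ?thesis
        using assms(1) adm by (simp add: Cons q Sec valid_def)
    qed
  qed
qed

text \<open>
  Existence: after an \<open>x\<close> that was chosen because \<open>x \<ge> 2z + m\<close>, a following secondary particle is
  this same \<open>z\<close>, so the comparison is literally the condition required between the two, and likewise
  after a \<open>z\<close>.
\<close>

lemma valid_interleave:
  assumes "length cs = length xs + 2 * length zs"
    and "sorted_wrt (>) xs" "\<forall>x \<in> set xs. x \<ge> 0"
    and "sorted_wrt (\<ge>) zs" "\<forall>z \<in> set zs. z \<ge> 0"
  shows "valid (interleave cs xs zs)"
  using assms
proof (induction cs xs zs rule: interleave.induct)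
  case (1 cs)
  then show ?case by (simp add: valid_def)
next
  case (2 cs x xs)
  then obtain c ds where cs: "cs = c # ds"
    by (cases cs) auto
  show ?case
    using 2 valid_Cons_single[of "interleave ds xs []" x c] read_interleave[of ds xs "[]"] by (auto simp: cs)
next
  case (3 cs z zs)
  then obtain c c' ds where cs: "cs = c # c' # ds"
    by (auto simp: Suc_length_conv length_Suc_conv)
  show ?case
    using 3 valid_Cons_pair[of "interleave ds [] zs" z c' c] read_interleave[of ds "[]" zs] by (auto simp: cs)
next
  case (4 cs x xs z zs)
  then obtain c c' ds where cs: "cs = c # c' # ds"
    by (auto simp: Suc_length_conv length_Suc_conv)
  show ?case
  proof (cases "x \<ge> 2 * z + least_pot (c' # ds)")
    case True
    then show ?thesis
      using 4 valid_Cons_single[of "interleave (c' # ds) xs (z # zs)" x c] read_interleave[of "c' # ds" xs "z # zs"]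
      by (auto simp: cs)
  next
    case False
    then show ?thesis
      using 4 valid_Cons_pair[of "interleave ds (x # xs) zs" z c' c] read_interleave[of ds "x # xs" zs]
      by (auto simp: cs)
  qed
qed

definition word_stats :: "nat \<Rightarrow> nat \<Rightarrow> nat \<Rightarrow> prim list \<Rightarrow> bool" where
  "word_stats u v w cs \<longleftrightarrow>
     length (filter (\<lambda>c. color_of (Prim c) = Col_a) cs) = u \<and>
     length (filter (\<lambda>c. color_of (Prim c) = Col_b) cs) = v \<and>
     length (filter (\<lambda>c. overlined (Prim c)) cs) = w"

text \<open>
  The common parameters of both families: a word, a strictly decreasing list and a weakly decreasing
  list. The entry \<open>n\<close> is the size of the sequences that they encode.
\<close>

definition triples :: "nat \<Rightarrow> nat \<Rightarrow> nat \<Rightarrow> nat \<Rightarrow> (prim list \<times> int list \<times> int list) set" where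
  "triples n u v w = {(cs, xs, zs). word_stats u v w cs \<and>
     length cs = length xs + 2 * length zs \<and>
     sorted_wrt (>) xs \<and> (\<forall>x \<in> set xs. x \<ge> 0) \<and>
     sorted_wrt (\<ge>) zs \<and> (\<forall>z \<in> set zs. z \<ge> 0) \<and>
     least_size cs + sum_list xs + 2 * sum_list zs = int n}"

text \<open>
  For a secondary particle, the parity of the potential is that of \<open>D c c'\<close>, so that \<open>counted_twice\<close>
  depends on the letters only: it holds exactly if both of them are over-lined, and the particle itself
  is over-lined exactly if one of them is.
\<close>

lemma letters_stats:
  "num_a (color_of s) = length (filter (\<lambda>c. color_of (Prim c) = Col_a) (letters s))"
  "num_b (color_of s) = length (filter (\<lambda>c. color_of (Prim c) = Col_b) (letters s))"
  "admissible (k, s) \<Longrightarrow>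
     of_bool (overlined s) + 2 * of_bool (counted_twice (k, s)) =
     length (filter (\<lambda>c. overlined (Prim c)) (letters s))"
proof -
  have sec: "num_a (color_of (Sec c c')) = length (filter (\<lambda>c. color_of (Prim c) = Col_a) [c, c']) \<and>
      num_b (color_of (Sec c c')) = length (filter (\<lambda>c. color_of (Prim c) = Col_b) [c, c'])" for c c'
    by (cases c; cases c') (simp_all add: color_of_def)
  have prim: "num_a (color_of (Prim c)) = length (filter (\<lambda>c. color_of (Prim c) = Col_a) [c]) \<and>
      num_b (color_of (Prim c)) = length (filter (\<lambda>c. color_of (Prim c) = Col_b) [c])" for c
    by (cases c) (simp_all add: color_of_def)
  show "num_a (color_of s) = length (filter (\<lambda>c. color_of (Prim c) = Col_a) (letters s))"
    "num_b (color_of s) = length (filter (\<lambda>c. color_of (Prim c) = Col_b) (letters s))"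
    using sec prim by (cases s; simp)+
  show "of_bool (overlined s) + 2 * of_bool (counted_twice (k, s)) =
     length (filter (\<lambda>c. overlined (Prim c)) (letters s))" if "admissible (k, s)"
  proof (cases s)
    case (Prim c)
    then show ?thesis using that
      by (cases c) (auto simp: overlined_def color_of_def counted_twice_def)
  next
    case (Sec c c')
    then show ?thesis using that
      by (cases c; cases c') (auto simp: overlined_def color_of_def counted_twice_def)
  qed
qed

lemma word_stats_word:
  assumes "\<forall>p \<in> set \<pi>. admissible p"
  shows "word_stats u v w (word \<pi>) \<longleftrightarrow>
     (\<Sum>(k, s)\<leftarrow>\<pi>. num_a (color_of s)) = u \<and>
     (\<Sum>(k, s)\<leftarrow>\<pi>. num_b (color_of s)) = v \<and>
     length (filter (\<lambda>(k, s). overlined s) \<pi>) + 2 * length (filter counted_twice \<pi>) = w"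
proof -
  have "length (filter (\<lambda>c. color_of (Prim c) = Col_a) (word \<pi>)) = (\<Sum>(k, s)\<leftarrow>\<pi>. num_a (color_of s)) \<and>
     length (filter (\<lambda>c. color_of (Prim c) = Col_b) (word \<pi>)) = (\<Sum>(k, s)\<leftarrow>\<pi>. num_b (color_of s)) \<and>
     length (filter (\<lambda>c. overlined (Prim c)) (word \<pi>)) =
       length (filter (\<lambda>(k, s). overlined s) \<pi>) + 2 * length (filter counted_twice \<pi>)"
    using assms
  proof (induction \<pi>)
    case (Cons p \<pi>)
    obtain k s where p: "p = (k, s)" by force
    have "admissible (k, s)" using Cons.prems p by simp
    from letters_stats(3)[OF this] Cons show ?case
      by (auto simp: p letters_stats(1,2) of_bool_def split: if_splits)
  qed simp
  then show ?thesis by (simp add: word_stats_def)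
qed

lemma bij_betw_interleave:
  "bij_betw (\<lambda>(cs, xs, zs). interleave cs xs zs) (triples n u v w) (seqs_B n u v w)"
proof -
  have *: "seqs_B n u v w = {\<pi>. valid \<pi> \<and> word_stats u v w (word \<pi>) \<and> seq_size \<pi> = int n}"
    using word_stats_word by (auto simp: seqs_B_def valid_def)
  show ?thesis
  proof (rule bij_betw_byWitness[where f' = "\<lambda>\<pi>. (word \<pi>, singles \<pi>, pairs \<pi>)"])
    show "\<forall>t\<in>triples n u v w. (word (case t of (cs, xs, zs) \<Rightarrow> interleave cs xs zs),
        singles (case t of (cs, xs, zs) \<Rightarrow> interleave cs xs zs),
        pairs (case t of (cs, xs, zs) \<Rightarrow> interleave cs xs zs)) = t"
      using read_interleave by (auto simp: triples_def)
    show "\<forall>\<pi>\<in>seqs_B n u v w. (case (word \<pi>, singles \<pi>, pairs \<pi>) of (cs, xs, zs) \<Rightarrow> interleave cs xs zs) = \<pi>"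
      using interleave_word_singles_pairs by (auto simp: *)
    show "(\<lambda>(cs, xs, zs). interleave cs xs zs) ` triples n u v w \<subseteq> seqs_B n u v w"
      using read_interleave valid_interleave seq_size_B by (auto simp: * triples_def valid_def)
    show "(\<lambda>\<pi>. (word \<pi>, singles \<pi>, pairs \<pi>)) ` seqs_B n u v w \<subseteq> triples n u v w"
      using singles_decreasing pairs_decreasing singles_nonneg seq_size_B
      by (auto simp: * triples_def length_word sorted_wrt_append valid_def)
  qed
qed

section \<open>Sequences of primary particles\<close>

fun raise :: "prim list \<Rightarrow> int list \<Rightarrow> (int \<times> prim) list" where
  "raise (c # cs) (y # ys) = (least_pot (c # cs) + y, c) # raise cs ys"
| "raise _ _ = []"

fun excess :: "(int \<times> prim) list \<Rightarrow> int list" where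
  "excess [] = []"
| "excess ((k, c) # \<pi>) = (k - least_pot (c # map snd \<pi>)) # excess \<pi>"

lemma raise_excess: "raise (map snd \<pi>) (excess \<pi>) = \<pi>"
  by (induction \<pi> rule: excess.induct) auto

lemma raise_inverse:
  assumes "length cs = length ys"
  shows "map snd (raise cs ys) = cs \<and> excess (raise cs ys) = ys"
  using assms by (induction cs ys rule: raise.induct) auto

lemma length_excess: "length (excess \<pi>) = length \<pi>"
  by (induction \<pi> rule: excess.induct) auto

lemma seq_size_A: "seq_size \<pi> = least_size (map snd \<pi>) + sum_list (excess \<pi>)"
  by (induction \<pi> rule: excess.induct) (auto simp: seq_size_def)

lemma min_diff_D_iff_excess:
  "min_diff D \<pi> \<and> (\<forall>(k, c) \<in> set \<pi>. k > 0) \<longleftrightarrow>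
   sorted_wrt (\<ge>) (excess \<pi>) \<and> (\<forall>y \<in> set (excess \<pi>). y \<ge> 0)"
proof (induction \<pi>)
  case (Cons p \<pi>)
  obtain k c where p: "p = (k, c)" by force
  show ?case
  proof (cases \<pi>)
    case (Cons q \<rho>)
    obtain l d where q: "q = (l, d)" by force
    have "min_diff D (p # \<pi>) \<and> (\<forall>(k, c) \<in> set (p # \<pi>). k > 0) \<longleftrightarrow>
      k - l \<ge> D c d \<and> k > 0 \<and> min_diff D \<pi> \<and> (\<forall>(k, c) \<in> set \<pi>. k > 0)"
      by (auto simp: p q Cons)
    also have "\<dots> \<longleftrightarrow> k - l \<ge> D c d \<and> k > 0 \<and> sorted_wrt (\<ge>) (excess \<pi>) \<and> (\<forall>y \<in> set (excess \<pi>). y \<ge> 0)"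
      using Cons.IH by simp
    also have "\<dots> \<longleftrightarrow> sorted_wrt (\<ge>) (excess (p # \<pi>)) \<and> (\<forall>y \<in> set (excess (p # \<pi>)). y \<ge> 0)"
      using least_pot_Cons_pos[of d "map snd \<rho>"] D_bounds[of c d] by (auto simp: p q Cons)
    finally show ?thesis .
  qed (auto simp: p)
qed simp

text \<open>
  \<open>X\<close> consists of the elements of odd multiplicity.
\<close>

lemma ex_single_double:
  fixes M :: "'a multiset"
  shows "\<exists>X Z. finite X \<and> M = mset_set X + Z + Z"
proof (induction M)
  case empty
  show ?case by (rule exI[of _ "{}"]) auto
next
  case (add y M)
  then obtain X Z where *: "finite X" "M = mset_set X + Z + Z" by blast
  show ?case
  proof (cases "y \<in> X")
    case True
    then have "add_mset y M = mset_set (X - {y}) + add_mset y Z + add_mset y Z"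
      using * mset_set.remove[of X y] by simp
    with * show ?thesis by blast
  next
    case False
    then have "add_mset y M = mset_set (insert y X) + Z + Z"
      using * by simp
    with * show ?thesis by blast
  qed
qed

lemma single_double_unique:
  assumes "distinct xs" "distinct xs'"
    and eq: "mset xs + mset zs + mset zs = mset xs' + mset zs' + mset zs'"
  shows "mset xs = mset xs' \<and> mset zs = mset zs'"
proof -
  have "count (mset xs) y = count (mset xs') y \<and> count (mset zs) y = count (mset zs') y" for y
  proof -
    have "count (mset xs) y \<le> 1" "count (mset xs') y \<le> 1"
      using assms by (auto simp: distinct_count_atmost_1)
    moreover have "count (mset xs) y + 2 * count (mset zs) y = count (mset xs') y + 2 * count (mset zs') y"
      using arg_cong[OF eq, of "\<lambda>M. count M y"] by (simp only: count_union) 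
    ultimately show ?thesis by presburger
  qed
  then show ?thesis by (auto intro: multiset_eqI)
qed

lemma decreasing_unique:
  fixes xs ys :: "'a :: linorder list"
  assumes "sorted_wrt (\<ge>) xs" "sorted_wrt (\<ge>) ys" "mset xs = mset ys"
  shows "xs = ys"
proof -
  have "sorted (rev xs)" "sorted (rev ys)" "mset (rev xs) = mset (rev ys)"
    using assms by (simp_all add: sorted_wrt_rev)
  then have "rev xs = rev ys"
    by (metis properties_for_sort)
  then show ?thesis by simp
qed

lemma strict_decreasing:
  fixes xs :: "'a :: linorder list"
  shows "sorted_wrt (>) xs \<longleftrightarrow> sorted_wrt (\<ge>) xs \<and> distinct xs"
  by (induction xs) (auto simp: order.strict_iff_order)

definition blend :: "int list \<Rightarrow> int list \<Rightarrow> int list" where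
  "blend xs zs = rev (sort (xs @ zs @ zs))"

lemma blend_properties:
  "sorted_wrt (\<ge>) (blend xs zs)" "mset (blend xs zs) = mset xs + mset zs + mset zs"
  "length (blend xs zs) = length xs + 2 * length zs" "set (blend xs zs) = set xs \<union> set zs"
  "sum_list (blend xs zs) = sum_list xs + 2 * sum_list zs"
proof -
  show m: "mset (blend xs zs) = mset xs + mset zs + mset zs"
    by (simp add: blend_def)
  show "sum_list (blend xs zs) = sum_list xs + 2 * sum_list zs"
    unfolding sum_mset_sum_list[symmetric] m by simp
qed (auto simp: blend_def sorted_wrt_rev)

text \<open>
  Injectivity and surjectivity both come from the decomposition of a multiset by the parity of its
  multiplicities, as decreasing lists are determined by their multisets.
\<close>

lemma bij_betw_raise:
  "bij_betw (\<lambda>(cs, xs, zs). raise cs (blend xs zs)) (triples n u v w) (seqs_A n u v w)"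
proof -
  have filter_snd: "length (filter (\<lambda>(k, c). P c) \<pi>) = length (filter P (map snd \<pi>))"
    for P and \<pi> :: "(int \<times> prim) list"
    by (induction \<pi>) auto
  have A: "seqs_A n u v w = {\<pi>. word_stats u v w (map snd \<pi>) \<and>
      sorted_wrt (\<ge>) (excess \<pi>) \<and> (\<forall>y \<in> set (excess \<pi>). y \<ge> 0) \<and>
      least_size (map snd \<pi>) + sum_list (excess \<pi>) = int n}"
    unfolding seqs_A_def word_stats_def filter_snd seq_size_A conj_assoc[symmetric] min_diff_D_iff_excess
    by (rule Collect_cong) blast
  show ?thesis
  proof (rule bij_betw_imageI)
    show "inj_on (\<lambda>(cs, xs, zs). raise cs (blend xs zs)) (triples n u v w)"
    proof (rule inj_onI)
      fix s t
      assume "s \<in> triples n u v w" "t \<in> triples n u v w"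
        and "(case s of (cs, xs, zs) \<Rightarrow> raise cs (blend xs zs)) =
             (case t of (cs, xs, zs) \<Rightarrow> raise cs (blend xs zs))"
      then obtain cs xs zs cs' xs' zs' where st: "s = (cs, xs, zs)" "t = (cs', xs', zs')"
        and t: "(cs, xs, zs) \<in> triples n u v w" "(cs', xs', zs') \<in> triples n u v w"
        and eq: "raise cs (blend xs zs) = raise cs' (blend xs' zs')"
        by (cases s, cases t) auto
      have "length cs = length (blend xs zs)" "length cs' = length (blend xs' zs')"
        using t by (simp_all add: triples_def blend_properties)
      with raise_inverse eq have *: "cs = cs'" "blend xs zs = blend xs' zs'"
        by metis+
      have xs: "sorted_wrt (>) xs" "sorted_wrt (>) xs'" and zs: "sorted_wrt (\<ge>) zs" "sorted_wrt (\<ge>) zs'"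
        using t by (simp_all add: triples_def)
      have "mset xs = mset xs'" "mset zs = mset zs'"
        using single_double_unique[of xs xs' zs zs'] xs arg_cong[OF *(2), of mset]
        by (simp_all add: strict_decreasing blend_properties)
      then have "xs = xs'" "zs = zs'"
        using xs zs decreasing_unique by (auto simp: strict_decreasing)
      with * st show "s = t" by simp
    qed
    show "(\<lambda>(cs, xs, zs). raise cs (blend xs zs)) ` triples n u v w = seqs_A n u v w"
    proof (intro Set.set_eqI iffI)
      fix \<pi> assume "\<pi> \<in> (\<lambda>(cs, xs, zs). raise cs (blend xs zs)) ` triples n u v w"
      then obtain cs xs zs where t: "(cs, xs, zs) \<in> triples n u v w" and \<pi>: "\<pi> = raise cs (blend xs zs)"
        by auto
      have "map snd \<pi> = cs \<and> excess \<pi> = blend xs zs"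
        unfolding \<pi> by (rule raise_inverse) (use t in \<open>simp add: triples_def blend_properties\<close>)
      with t show "\<pi> \<in> seqs_A n u v w"
        by (auto simp: A triples_def blend_properties)
    next
      fix \<pi> assume \<pi>: "\<pi> \<in> seqs_A n u v w"
      obtain X Z where XZ: "finite X" "mset (excess \<pi>) = mset_set X + Z + Z"
        using ex_single_double by blast
      define xs where "xs = rev (sorted_list_of_set X)"
      define zs where "zs = rev (sorted_list_of_multiset Z)"
      have mset: "mset xs = mset_set X" "mset zs = Z"
        using XZ(1) by (simp_all add: xs_def zs_def) (metis mset_sorted_list_of_multiset sorted_list_of_mset_set)
      have blend: "excess \<pi> = blend xs zs"
        by (rule decreasing_unique) (use \<pi> XZ mset in \<open>simp_all add: A blend_properties\<close>)
      have "sorted_wrt (>) xs" "sorted_wrt (\<ge>) zs"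
        by (simp_all add: strict_decreasing xs_def zs_def sorted_wrt_rev)
      moreover have "length (map snd \<pi>) = length xs + 2 * length zs"
        using blend length_excess[of \<pi>] by (simp add: blend_properties)
      moreover have "least_size (map snd \<pi>) + sum_list (excess \<pi>) = int n"
        "\<forall>y \<in> set (excess \<pi>). y \<ge> 0"
        using \<pi> by (simp_all add: A)
      then have "least_size (map snd \<pi>) + sum_list xs + 2 * sum_list zs = int n"
        "\<forall>y \<in> set xs \<union> set zs. y \<ge> 0"
        unfolding blend by (simp_all add: blend_properties)
      ultimately have "(map snd \<pi>, xs, zs) \<in> triples n u v w"
        using \<pi> by (simp add: triples_def A)
      moreover have "\<pi> = raise (map snd \<pi>) (blend xs zs)"
        using raise_excess[of \<pi>] blend by simp
      ultimately show "\<pi> \<in> (\<lambda>(cs, xs, zs). raise cs (blend xs zs)) ` triples n u v w"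
        by (auto simp: image_iff intro!: bexI[of _ "(map snd \<pi>, xs, zs)"])
    qed
  qed
qed

lemma num_A_eq_num_B: "num_A n u v w = num_B n u v w"
  using bij_betw_same_card[OF bij_betw_raise[of n u v w]] bij_betw_same_card[OF bij_betw_interleave[of n u v w]]
  by (simp add: num_A_def num_B_def)

section \<open>The generating function of the primary sequences\<close>

definition plain :: "prim \<Rightarrow> bool" where
  "plain c \<longleftrightarrow> \<not> overlined (Prim c)"

fun particle_rank :: "int \<times> prim \<Rightarrow> int" where
  "particle_rank (k, B_bar) = 4 * k"
| "particle_rank (k, A_bar) = 4 * k + 1"
| "particle_rank (k, A_plain) = 4 * k + 2"
| "particle_rank (k, B_plain) = 4 * k + 3"

text \<open>
  The difference condition compares positions in the linear order of all primary particles by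
  potential and then by \<open>B_bar\<close>, \<open>A_bar\<close>, \<open>A_plain\<close>, \<open>B_plain\<close>; a particle may be repeated exactly if
  it is not over-lined.
\<close>

lemma D_iff_particle_rank: "k - l \<ge> D c d \<longleftrightarrow> particle_rank (l, d) < particle_rank (k, c) + of_bool (plain c)"
  by (cases c; cases d) (auto simp: plain_def overlined_def)

lemma min_diff_D_Cons:
  "min_diff D (p # \<pi>) \<longleftrightarrow> min_diff D \<pi> \<and> (\<forall>q \<in> set \<pi>. particle_rank q < particle_rank p + of_bool (plain (snd p)))"
proof (induction \<pi> arbitrary: p)
  case (Cons q \<pi>)
  show ?case
    using Cons[of q] D_iff_particle_rank[of "snd p" "snd q" "fst p" "fst q"]
    by (fastforce simp: of_bool_def split: if_splits)
qed simp

definition positive_potentials :: "(int \<times> prim) list \<Rightarrow> bool" where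
  "positive_potentials \<pi> \<longleftrightarrow> (\<forall>(k, c) \<in> set \<pi>. k > 0)"

definition overpartitions :: "nat \<Rightarrow> (int \<times> prim) list set" where
  "overpartitions n = {\<pi>. min_diff D \<pi> \<and> positive_potentials \<pi> \<and> seq_size \<pi> = int n}"

definition overpartitions_below :: "int \<Rightarrow> nat \<Rightarrow> (int \<times> prim) list set" where
  "overpartitions_below N n = {\<pi> \<in> overpartitions n. \<forall>p \<in> set \<pi>. particle_rank p < N}"

lemma positive_size:
  assumes "positive_potentials \<pi>"
  shows "int (length \<pi>) \<le> seq_size \<pi>" "\<forall>(k, c) \<in> set \<pi>. k \<le> seq_size \<pi>"
  using assms by (induction \<pi>) (fastforce simp: positive_potentials_def seq_size_def)+

lemma finite_overpartitions: "finite (overpartitions n)"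
proof (rule finite_subset)
  have "finite (UNIV :: prim set)"
    by (rule finite_subset[of _ "{B_bar, A_bar, A_plain, B_plain}"]) (auto intro: prim.exhaust)
  then show "finite {\<pi>. set \<pi> \<subseteq> {0..int n} \<times> (UNIV :: prim set) \<and> length \<pi> \<le> n}"
    by (intro finite_lists_length_le finite_cartesian_product) auto
  show "overpartitions n \<subseteq> {\<pi>. set \<pi> \<subseteq> {0..int n} \<times> UNIV \<and> length \<pi> \<le> n}"
    using positive_size by (fastforce simp: overpartitions_def positive_potentials_def)
qed

lemma finite_overpartitions_below: "finite (overpartitions_below N n)"
  by (simp add: overpartitions_below_def finite_overpartitions)

text \<open>
  Either the largest admitted particle does not occur, or it stands first; what follows it may contain
  it again exactly if it is not over-lined.
\<close>

lemma overpartitions_below_step: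
  assumes "k > 0"
  shows "overpartitions_below (particle_rank (int k, c) + 1) n =
    overpartitions_below (particle_rank (int k, c)) n \<union>
    (if n < k then {}
     else (#) (int k, c) ` overpartitions_below (particle_rank (int k, c) + of_bool (plain c)) (n - k))"
    (is "?L = ?R")
proof (intro Set.set_eqI iffI)
  fix \<pi> assume \<pi>: "\<pi> \<in> ?L"
  show "\<pi> \<in> ?R"
  proof (cases "\<forall>p \<in> set \<pi>. particle_rank p < particle_rank (int k, c)")
    case True
    then show ?thesis using \<pi> by (simp add: overpartitions_below_def)
  next
    case False
    then obtain p \<rho> where p: "\<pi> = p # \<rho>"
      by (cases \<pi>) auto
    have md: "min_diff D (p # \<rho>)" "seq_size (p # \<rho>) = int n" "positive_potentials (p # \<rho>)"
      "\<forall>q\<in>set (p # \<rho>). particle_rank q \<le> particle_rank (int k, c)"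
      using \<pi> p by (auto simp: overpartitions_below_def overpartitions_def)
    have "particle_rank p = particle_rank (int k, c)"
      using md False p unfolding min_diff_D_Cons by (fastforce simp: of_bool_def split: if_splits)
    then have p': "p = (int k, c)"
      by (cases p; cases "snd p"; cases c; simp; presburger)
    have "int k \<le> int n"
      using positive_size(2)[OF md(3)] md(2) p' by auto
    then show ?thesis
      using md p p' unfolding min_diff_D_Cons
      by (auto simp: overpartitions_below_def overpartitions_def positive_potentials_def seq_size_def of_nat_diff)
  qed
next
  fix \<pi> assume \<pi>: "\<pi> \<in> ?R"
  then show "\<pi> \<in> ?L"
    using assms
    by (force simp: overpartitions_below_def overpartitions_def positive_potentials_def min_diff_D_Cons
          seq_size_def of_nat_diff of_bool_def split: if_splits)
qed

lemma overpartitions_below_4: "overpartitions_below 4 n = (if n = 0 then {[]} else {})"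
proof -
  have *: "particle_rank (k, c) \<ge> 4" if "k > 0" for k c
    using that by (cases c) auto
  have "\<pi> = []" if "positive_potentials \<pi>" "\<forall>p \<in> set \<pi>. particle_rank p < 4" for \<pi>
  proof (cases \<pi>)
    case (Cons p \<rho>)
    then show ?thesis
      using that *[of "fst p" "snd p"] by (auto simp: positive_potentials_def)
  qed
  then have "overpartitions_below 4 n \<subseteq> {[]}"
    by (auto simp: overpartitions_below_def overpartitions_def)
  moreover have "[] \<in> overpartitions_below 4 n \<longleftrightarrow> n = 0"
    by (simp add: overpartitions_below_def overpartitions_def seq_size_def positive_potentials_def)
  ultimately show ?thesis
    by auto
qed

lemma overpartitions_below_eq:
  assumes "n \<le> K"
  shows "overpartitions_below (4 * int K + 4) n = overpartitions n"
proof -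
  have "particle_rank (k, c) < 4 * int K + 4" if "k \<le> int n" for k c
    using that assms by (cases c) auto
  then show ?thesis
    using positive_size(2) by (fastforce simp: overpartitions_below_def overpartitions_def)
qed

context
  fixes a b c d :: "'k :: field"
begin

fun letter_weight :: "prim \<Rightarrow> 'k" where
  "letter_weight B_bar = b * c"
| "letter_weight A_bar = a * c"
| "letter_weight A_plain = a * d"
| "letter_weight B_plain = b * d"

definition weight :: "(int \<times> prim) list \<Rightarrow> 'k" where
  "weight \<pi> = (\<Prod>p\<leftarrow>\<pi>. letter_weight (snd p))"

definition overpartition_series_below :: "int \<Rightarrow> 'k fps" where
  "overpartition_series_below N = Abs_fps (\<lambda>n. \<Sum>\<pi>\<in>overpartitions_below N n. weight \<pi>)"

definition overpartition_series :: "'k fps" where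
  "overpartition_series = Abs_fps (\<lambda>n. \<Sum>\<pi>\<in>overpartitions n. weight \<pi>)"

text \<open>
  In the case of an over-lined particle this is multiplication by \<open>1 + t q\<^sup>k\<close>, otherwise the new
  series occurs on both sides and the equation says that it is the old one divided by \<open>1 - t q\<^sup>k\<close>.
\<close>

lemma overpartition_series_below_step:
  assumes "k > 0"
  shows "overpartition_series_below (particle_rank (int k, e) + 1) =
    overpartition_series_below (particle_rank (int k, e)) +
    fps_const (letter_weight e) * fps_X ^ k *
      overpartition_series_below (particle_rank (int k, e) + of_bool (plain e))"
proof (rule fps_ext)
  fix n
  let ?p = "(int k, e)"
  let ?S = "overpartitions_below (particle_rank ?p + of_bool (plain e)) (n - k)"
  have "(\<Sum>\<pi>\<in>overpartitions_below (particle_rank ?p + 1) n. weight \<pi>) =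
    (\<Sum>\<pi>\<in>overpartitions_below (particle_rank ?p) n. weight \<pi>) +
    (\<Sum>\<pi>\<in>(if n < k then {} else (#) ?p ` ?S). weight \<pi>)"
    unfolding overpartitions_below_step[OF assms]
    by (rule sum.union_disjoint)
       (auto simp: finite_overpartitions_below, auto simp: overpartitions_below_def)
  also have "(\<Sum>\<pi>\<in>(if n < k then {} else (#) ?p ` ?S). weight \<pi>) =
    (if n < k then 0 else letter_weight e * (\<Sum>\<pi>\<in>?S. weight \<pi>))"
    by (simp add: sum.reindex weight_def sum_distrib_left)
  finally show "overpartition_series_below (particle_rank ?p + 1) $ n = (overpartition_series_below (particle_rank ?p) +
    fps_const (letter_weight e) * fps_X ^ k * overpartition_series_below (particle_rank ?p + of_bool (plain e))) $ n"
    by (simp add: overpartition_series_below_def mult.assoc fps_X_power_mult_nth)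
qed

lemma overpartition_series_below_4: "overpartition_series_below 4 = 1"
  by (rule fps_ext) (simp add: overpartition_series_below_def overpartitions_below_4 weight_def)

text \<open>
  The ranks below \<open>4 K + 4\<close> belong to the potentials \<open>1, \<dots>, K\<close>. One more potential means four more
  particles, one for each primary state.
\<close>

lemma overpartition_series_below_product:
  "overpartition_series_below (4 * int K + 4) *
     ((\<Prod>k<K. 1 - fps_const (a * d) * fps_X * fps_X ^ k) * (\<Prod>k<K. 1 - fps_const (b * d) * fps_X * fps_X ^ k)) =
   (\<Prod>k<K. 1 - (- (fps_const (a * c) * fps_X)) * fps_X ^ k) * (\<Prod>k<K. 1 - (- (fps_const (b * c) * fps_X)) * fps_X ^ k)"
proof (induction K)
  case 0
  show ?case by (simp add: overpartition_series_below_4)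
next
  case (Suc K)
  let ?F = "overpartition_series_below" and ?k = "4 * int (Suc K)" and ?q = "fps_X ^ Suc K :: 'k fps"
  have 1: "?F (?k + 1) = ?F ?k + fps_const (b * c) * ?q * ?F ?k"
    using overpartition_series_below_step[of "Suc K" B_bar] by (simp add: plain_def overlined_def)
  have 2: "?F (?k + 2) = ?F (?k + 1) + fps_const (a * c) * ?q * ?F (?k + 1)"
    using overpartition_series_below_step[of "Suc K" A_bar] by (simp add: plain_def overlined_def)
  have 3: "?F (?k + 3) = ?F (?k + 2) + fps_const (a * d) * ?q * ?F (?k + 3)"
    using overpartition_series_below_step[of "Suc K" A_plain] by (simp add: plain_def overlined_def)
  have 4: "?F (?k + 4) = ?F (?k + 3) + fps_const (b * d) * ?q * ?F (?k + 4)"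
    using overpartition_series_below_step[of "Suc K" B_plain] by (simp add: plain_def overlined_def)
  \<comment> \<open>The four factors for the potential \<open>K + 1\<close>, and below them the partial products up to \<open>K\<close>.\<close>
  define x y x' y' where
    "x = 1 - fps_const (a * d) * ?q" "y = 1 - fps_const (b * d) * ?q"
    "x' = 1 + fps_const (a * c) * ?q" "y' = 1 + fps_const (b * c) * ?q"
  note defs = this
  define P Q P' Q' where
    "P = (\<Prod>k<K. 1 - fps_const (a * d) * fps_X * fps_X ^ k)"
    "Q = (\<Prod>k<K. 1 - fps_const (b * d) * fps_X * fps_X ^ k)"
    "P' = (\<Prod>k<K. 1 - (- (fps_const (a * c) * fps_X)) * fps_X ^ k)"
    "Q' = (\<Prod>k<K. 1 - (- (fps_const (b * c) * fps_X)) * fps_X ^ k)"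
  note prods = this
  have "?F (?k + 4) * y = ?F (?k + 3)" "?F (?k + 3) * x = ?F (?k + 2)"
    using 3 4 by (simp_all add: defs algebra_simps)
  moreover have "?F (?k + 2) = x' * y' * ?F (4 * int K + 4)"
    using 1 2 by (simp add: defs algebra_simps)
  ultimately have step: "?F (?k + 4) * y * x = x' * y' * ?F (4 * int K + 4)"
    by simp
  have "?F (?k + 4) * ((P * x) * (Q * y)) = ?F (?k + 4) * y * x * (P * Q)"
    by (simp only: mult_ac)
  also have "\<dots> = x' * y' * (?F (4 * int K + 4) * (P * Q))"
    unfolding step by (simp only: mult_ac)
  also have "\<dots> = (P' * x') * (Q' * y')"
    using Suc unfolding prods[symmetric] by (simp only: mult_ac)
  finally show ?case
    unfolding defs prods by (simp add: mult.assoc)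
qed

end

section \<open>Passage to the infinite product\<close>

definition agree :: "nat \<Rightarrow> 'a fps \<Rightarrow> 'a fps \<Rightarrow> bool" where
  "agree n f g \<longleftrightarrow> (\<forall>i\<le>n. f $ i = g $ i)"

lemma agree_mult:
  fixes f :: "'a :: comm_ring_1 fps"
  assumes "agree n f f'" "agree n g g'"
  shows "agree n (f * g) (f' * g')"
  using assms by (auto simp: agree_def fps_mult_nth intro!: sum.cong)

lemma partial_qpoch_stable:
  fixes x :: "'k :: field fps"
  assumes "x $ 0 = 0" "n \<le> K"
  shows "(\<Prod>k<K. 1 - x * fps_X ^ k) $ n = (\<Prod>k<n. 1 - x * fps_X ^ k) $ n"
  using assms(2)
proof (induction rule: dec_induct)
  case (step K)
  let ?P = "\<Prod>k<K. 1 - x * fps_X ^ k"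
  have "(?P * x * fps_X ^ K) $ n = 0"
    using step.hyps assms(1) by (simp add: fps_X_power_mult_right_nth)
  then show ?case
    using step.IH by (simp add: algebra_simps)
qed simp

text \<open>
  The factor with index \<open>k\<close> is \<open>1\<close> up to terms of order at least \<open>k + 1\<close>, so the coefficient of
  \<open>q\<^sup>n\<close> is that of the product of the first \<open>n\<close> factors. The limit has constant coefficient 1; its
  being nonzero is part of the convergence of an infinite product.
\<close>

lemma qpoch_inf_agree:
  fixes x :: "'k :: field fps"
  assumes "x $ 0 = 0"
  shows "agree n (qpoch_inf x) (\<Prod>k<n. 1 - x * fps_X ^ k)"
proof -
  define P where "P = Abs_fps (\<lambda>n. (\<Prod>k<n. 1 - x * fps_X ^ k) $ n)"
  have stable: "(\<Prod>k<K. 1 - x * fps_X ^ k) $ m = P $ m" if "m \<le> K" for m K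
    using partial_qpoch_stable[OF assms that] by (simp add: P_def)
  have "(\<lambda>K. \<Prod>k\<le>K. 1 - x * fps_X ^ k) \<longlonglongrightarrow> P"
  proof (rule tendsto_fpsI)
    fix m
    show "\<forall>\<^sub>F K in sequentially. (\<Prod>k\<le>K. 1 - x * fps_X ^ k) $ m = P $ m"
      unfolding eventually_sequentially
      using stable[of m "Suc _"] by (auto intro!: exI[of _ m] simp: lessThan_Suc_atMost)
  qed
  moreover have "P $ 0 = 1"
    by (simp add: P_def)
  ultimately have "raw_has_prod (\<lambda>k. 1 - x * fps_X ^ k) 0 P"
    by (auto simp: raw_has_prod_def)
  then have "qpoch_inf x = P"
    unfolding qpoch_inf_def using has_prod_unique[of "\<lambda>k. 1 - x * fps_X ^ k" P] by (auto simp: has_prod_def)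
  then show ?thesis
    using stable by (simp add: agree_def)
qed

lemma overpartition_series_eq:
  fixes a b c d :: "'k :: field"
  shows "overpartition_series a b c d =
     (qpoch_inf (- (fps_const (a * c) * fps_X)) * qpoch_inf (- (fps_const (b * c) * fps_X))) /
     (qpoch_inf (fps_const (a * d) * fps_X) * qpoch_inf (fps_const (b * d) * fps_X))"
    (is "_ = ?N / ?E")
proof -
  have "overpartition_series a b c d * ?E = ?N"
  proof (rule fps_ext)
    fix n
    have "agree n (overpartition_series a b c d) (overpartition_series_below a b c d (4 * int n + 4))"
      by (simp add: agree_def overpartition_series_def overpartition_series_below_def overpartitions_below_eq)
    then have "agree n (overpartition_series a b c d * ?E)
      (overpartition_series_below a b c d (4 * int n + 4) *
        ((\<Prod>k<n. 1 - fps_const (a * d) * fps_X * fps_X ^ k) * (\<Prod>k<n. 1 - fps_const (b * d) * fps_X * fps_X ^ k)))"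
      by (intro agree_mult qpoch_inf_agree) auto
    moreover have "agree n ?N ((\<Prod>k<n. 1 - (- (fps_const (a * c) * fps_X)) * fps_X ^ k) *
        (\<Prod>k<n. 1 - (- (fps_const (b * c) * fps_X)) * fps_X ^ k))"
      by (intro agree_mult qpoch_inf_agree) auto
    ultimately show "(overpartition_series a b c d * ?E) $ n = ?N $ n"
      unfolding overpartition_series_below_product by (simp add: agree_def)
  qed
  moreover have "?E $ 0 = 1"
    using qpoch_inf_agree[of "fps_const (a * d) * fps_X" 0] qpoch_inf_agree[of "fps_const (b * d) * fps_X" 0]
    by (simp add: agree_def)
  then have "?E \<noteq> 0"
    by auto
  ultimately show ?thesis
    using nonzero_mult_div_cancel_right[of ?E "overpartition_series a b c d"] by simp
qed

text \<open>
  Every letter carries one of \<open>a\<close>, \<open>b\<close> and one of \<open>c\<close>, \<open>d\<close>; in particular \<open>u + v - w\<close> is the number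
  of letters that are not over-lined, hence non-negative.
\<close>

lemma weight_eq:
  fixes a b c d :: "'k :: field"
  assumes "\<pi> \<in> seqs_A n u v w"
  shows "weight a b c d \<pi> = a ^ u * b ^ v * c ^ w * d powi (int u + int v - int w)"
proof -
  let ?u = "\<lambda>\<pi>. length (filter (\<lambda>(k, c). color_of (Prim c) = Col_a) \<pi>)"
  let ?v = "\<lambda>\<pi>. length (filter (\<lambda>(k, c). color_of (Prim c) = Col_b) \<pi>)"
  let ?w = "\<lambda>\<pi>. length (filter (\<lambda>(k, c). overlined (Prim c)) \<pi>)"
  let ?p = "\<lambda>\<pi>. length (filter (\<lambda>(k, c). \<not> overlined (Prim c)) \<pi>)"
  have "weight a b c d \<pi> = a ^ ?u \<pi> * b ^ ?v \<pi> * c ^ ?w \<pi> * d ^ ?p \<pi> \<and> ?u \<pi> + ?v \<pi> = ?w \<pi> + ?p \<pi>"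
    for \<pi> :: "(int \<times> prim) list"
  proof (induction \<pi>)
    case (Cons q \<pi>)
    then show ?case
      by (cases q; cases "snd q") (auto simp: weight_def overlined_def color_of_def)
  qed (simp add: weight_def)
  note * = this[of \<pi>]
  have stats: "?u \<pi> = u" "?v \<pi> = v" "?w \<pi> = w"
    using assms by (simp_all add: seqs_A_def)
  then have "int u + int v - int w = int (?p \<pi>)"
    using * by linarith
  then have "d powi (int u + int v - int w) = d ^ ?p \<pi>"
    by (simp only: power_int_of_nat)
  then show ?thesis
    using * stats by simp
qed

text \<open>
  Only finitely many terms contribute to the coefficient of \<open>q\<^sup>n\<close>, since a sequence of size \<open>n\<close> with
  positive potentials has at most \<open>n\<close> particles.
\<close>

lemma gf_num_A_has_sum: "(gf_term num_A a b c d has_sum overpartition_series a b c d) UNIV"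
proof (rule has_sum_fpsI)
  fix n :: nat
  define T where "T = {n} \<times> {..n} \<times> {..n} \<times> {..n}"
  define stat where "stat = (\<lambda>\<pi>. (length (filter (\<lambda>(k, c). color_of (Prim c) = Col_a) \<pi>),
      length (filter (\<lambda>(k, c). color_of (Prim c) = Col_b) \<pi>),
      length (filter (\<lambda>(k :: int, c). overlined (Prim c)) \<pi>)))"
  have seqs_A: "seqs_A n u v w = {\<pi> \<in> overpartitions n. stat \<pi> = (u, v, w)}" for u v w
    by (auto simp: seqs_A_def overpartitions_def positive_potentials_def stat_def)
  have stat: "stat \<pi> \<in> {..n} \<times> {..n} \<times> {..n}" if "\<pi> \<in> overpartitions n" for \<pi>
  proof -
    have "length \<pi> \<le> n"
      using positive_size(1)[of \<pi>] that by (simp add: overpartitions_def)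
    then show ?thesis
      by (auto simp: stat_def intro: order_trans[OF length_filter_le])
  qed
  have coeff: "(case t of (u, v, w) \<Rightarrow> gf_term num_A a b c d (n, u, v, w) $ n) =
      (\<Sum>\<pi> | \<pi> \<in> overpartitions n \<and> stat \<pi> = t. weight a b c d \<pi>)" for t
  proof -
    obtain u v w where t: "t = (u, v, w)" by (cases t)
    have "(\<Sum>\<pi>\<in>seqs_A n u v w. weight a b c d \<pi>) =
        of_nat (num_A n u v w) * (a ^ u * b ^ v * c ^ w * d powi (int u + int v - int w))"
      by (simp add: num_A_def weight_eq)
    then show ?thesis
      by (simp add: t gf_term_def seqs_A mult.assoc)
  qed
  have "overpartition_series a b c d $ n = (\<Sum>t\<in>{..n} \<times> {..n} \<times> {..n}. case t of (u, v, w) \<Rightarrow> gf_term num_A a b c d (n, u, v, w) $ n)"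
    unfolding overpartition_series_def coeff using stat
    by (simp, intro sum.group[symmetric] finite_overpartitions) blast+
  also have "\<dots> = (\<Sum>t\<in>T. gf_term num_A a b c d t $ n)"
    by (rule sum.reindex_bij_witness[of _ snd "Pair n"]) (auto simp: T_def)
  finally have T: "overpartition_series a b c d $ n = (\<Sum>t\<in>T. gf_term num_A a b c d t $ n)" .
  have zero: "gf_term num_A a b c d t $ n = 0" if "t \<notin> T" for t
  proof -
    obtain m u v w where t: "t = (m, u, v, w)" by (cases t)
    show ?thesis
    proof (cases "m = n")
      case True
      have "seqs_A n u v w = {}"
        using stat that True unfolding t T_def seqs_A by fastforce
      then show ?thesis by (simp add: t True gf_term_def num_A_def)
    qed (simp add: t gf_term_def)
  qed
  have nonzero: "{t \<in> UNIV. gf_term num_A a b c d t $ n \<noteq> 0} \<subseteq> T"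
    using zero by auto
  have "finite T"
    by (simp add: T_def)
  then show "finite {t \<in> UNIV. gf_term num_A a b c d t $ n \<noteq> 0}"
    using nonzero finite_subset by blast
  show "overpartition_series a b c d $ n =
      (\<Sum>t | t \<in> UNIV \<and> gf_term num_A a b c d t $ n \<noteq> 0. gf_term num_A a b c d t $ n)"
    unfolding T by (rule sum.mono_neutral_right) (use \<open>finite T\<close> nonzero in auto)
qed

theorem corollary1p10:
  fixes a b c d :: "'k::field"
  defines "R \<equiv>
      (qpoch_inf (- (fps_const (a * c) * fps_X)) * qpoch_inf (- (fps_const (b * c) * fps_X))) /
      (qpoch_inf (fps_const (a * d) * fps_X) * qpoch_inf (fps_const (b * d) * fps_X))"
  shows "(\<forall>n u v w. num_A n u v w = num_B n u v w) \<and>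
    (gf_term num_B a b c d has_sum R) UNIV \<and>
    (gf_term num_A a b c d has_sum R) UNIV"
proof -
  have "num_B = num_A"
    by (intro ext) (simp add: num_A_eq_num_B)
  then show ?thesis
    using gf_num_A_has_sum[of a b c d] by (simp add: R_def overpartition_series_eq)
qed

end
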